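(* Let $$\Omega_A = D^2+\frac{BAC+CAB}{2}+A^2+B\gamma-C\beta-A\delta,$$ $$\Omega_B = D^2+\frac{CBA+ABC}{2}+B^2+C\alpha-A\gamma-B\delta,$$ $$\Omega_C = D^2+\frac{ACB+BCA}{2}+C^2+A\beta-B\alpha-C\delta$$ in the Racah algebra $\Re$. Then the set $\{\Omega_A,\Omega_B,\Omega_C\}$ is invariant under the $D_6$-action on $\Re$. The generators $\sigma,\tau$ of $D_6$ act on these elements by $$\sigma(\Omega_A)=\Omega_B,\quad \sigma(\Omega_B)=\Omega_A,\quad \sigma(\Omega_C)=\Omega_C,$$ $$\tau(\Omega_A)=\Omega_B,\quad \tau(\Omega_B)=\Omega_C,\quad \tau(\Omega_C)=\Omega_A.$$
   Context: $\mathbb F$ is a field with $\operatorname{char}\mathbb F\neq 2$. All algebras are unital and associative. Write $[x,y]=xy-yx$. The Racah algebra $\Re$ is the $\mathbb F$-algebra defined by generators $A,B,C,D$ and the relations $[A,B]=[B,C]=[C,A]=2D$ together with the relations asserting that each of the elements $$\alpha=[A,D]+AC-BA,\qquad \beta=[B,D]+BA-CB,\qquad \gamma=[C,D]+CB-AC$$ is central in $\Re$. Set $\delta=A+B+C$. $D_6$ is the dihedral group with generators $\sigma,\tau$ and relations $\sigma^2=1$, $\tau^6=1$, $(\sigma\tau)^2=1$. The $D_6$-action on $\Re$ is the unique one for which $\sigma$ and $\tau$ act as $\mathbb F$-algebra antiautomorphisms with: $\sigma$ sends $A,B,C,D,\alpha,\beta,\gamma,\delta$ to $B,A,C,D,-\beta,-\alpha,-\gamma,\delta$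 respectively, and $\tau$ sends $A,B,C,D,\alpha,\beta,\gamma,\delta$ to $B,C,A,-D,\beta,\gamma,\alpha,\delta$ respectively. *)

theory Defs
  imports Complex_Main "HOL-Library.Poly_Mapping" "HOL-Algebra.Group_Action"
begin

section \<open>The free algebra on four generators\<close>

datatype racah_gen = GA | GB | GC | GD

text \<open>Words in the generators form the free monoid under concatenation.  It is written additively
  because the product of finitely supported functions in \<open>Poly_Mapping\<close> is the convolution over an
  additive (not necessarily commutative) exponent monoid; \<open>racah_word \<Rightarrow>\<^sub>0 'f\<close> is thus the
  monoid algebra of the free monoid, i.e. the free unital associative algebra on
  \<open>GA, GB, GC, GD\<close>.\<close>

datatype racah_word = Word (letters: "racah_gen list")

instantiation racah_word :: monoid_add
begin

definition zero_racah_word :: racah_word where "0 = Word []"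

definition plus_racah_word :: "racah_word \<Rightarrow> racah_word \<Rightarrow> racah_word"
  where "u + v = Word (letters u @ letters v)"

instance
  by standard (simp_all add: zero_racah_word_def plus_racah_word_def)

end

type_synonym 'f racah_free = "racah_word \<Rightarrow>\<^sub>0 'f"

definition free_gen :: "racah_gen \<Rightarrow> 'f::field racah_free"
  where "free_gen x = Poly_Mapping.single (Word [x]) 1"

definition free_const :: "'f::field \<Rightarrow> 'f racah_free"
  where "free_const c = Poly_Mapping.single 0 c"


section \<open>The Racah algebra\<close>

definition commutator :: "'a::ring_1 \<Rightarrow> 'a \<Rightarrow> 'a"
  where "commutator x y = x * y - y * x"

definition alpha_expr :: "'a::ring_1 \<Rightarrow> 'a \<Rightarrow> 'a \<Rightarrow> 'a \<Rightarrow> 'a"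
  where "alpha_expr a b c d = commutator a d + a * c - b * a"

definition beta_expr :: "'a::ring_1 \<Rightarrow> 'a \<Rightarrow> 'a \<Rightarrow> 'a \<Rightarrow> 'a"
  where "beta_expr a b c d = commutator b d + b * a - c * b"

definition gamma_expr :: "'a::ring_1 \<Rightarrow> 'a \<Rightarrow> 'a \<Rightarrow> 'a \<Rightarrow> 'a"
  where "gamma_expr a b c d = commutator c d + c * b - a * c"

definition racah_relators :: "'f::field racah_free set"
  where "racah_relators =
    (let a = free_gen GA; b = free_gen GB; c = free_gen GC; d = free_gen GD in
      {commutator a b - 2 * d, commutator b c - 2 * d, commutator c a - 2 * d} \<union>
      {commutator z x | z x. z \<in> {alpha_expr a b c d, beta_expr a b c d, gamma_expr a b c d}})"

inductive_set racah_ideal :: "'f::field racah_free set" where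
  relator: "r \<in> racah_relators \<Longrightarrow> r \<in> racah_ideal"
| zero: "0 \<in> racah_ideal"
| add: "p \<in> racah_ideal \<Longrightarrow> q \<in> racah_ideal \<Longrightarrow> p + q \<in> racah_ideal"
| mult_left: "p \<in> racah_ideal \<Longrightarrow> q * p \<in> racah_ideal"
| mult_right: "p \<in> racah_ideal \<Longrightarrow> p * q \<in> racah_ideal"

definition racah_rel :: "'f::field racah_free \<Rightarrow> 'f racah_free \<Rightarrow> bool"
  where "racah_rel p q \<longleftrightarrow> p - q \<in> racah_ideal"

lemma racah_ideal_uminus: "p \<in> racah_ideal \<Longrightarrow> - p \<in> racah_ideal"
  using racah_ideal.mult_left[of p "-1"] by simp

lemma racah_ideal_diff: "p \<in> racah_ideal \<Longrightarrow> q \<in> racah_ideal \<Longrightarrow> p - q \<in> racah_ideal"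
  using racah_ideal.add[of p "- q"] racah_ideal_uminus[of q] by simp

lemma equivp_racah_rel: "equivp (racah_rel :: 'f::field racah_free \<Rightarrow> _)"
proof (rule equivpI)
  show "reflp (racah_rel :: 'f racah_free \<Rightarrow> _)"
    by (rule reflpI) (simp add: racah_rel_def racah_ideal.zero)
  show "symp (racah_rel :: 'f racah_free \<Rightarrow> _)"
  proof (rule sympI)
    fix p q :: "'f racah_free"
    assume "racah_rel p q"
    then have "- (p - q) \<in> racah_ideal"
      unfolding racah_rel_def by (rule racah_ideal_uminus)
    then show "racah_rel q p" by (simp add: racah_rel_def algebra_simps)
  qed
  show "transp (racah_rel :: 'f racah_free \<Rightarrow> _)"
  proof (rule transpI)
    fix p q r :: "'f racah_free"
    assume "racah_rel p q" "racah_rel q r"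
    then have "(p - q) + (q - r) \<in> racah_ideal"
      unfolding racah_rel_def by (rule racah_ideal.add)
    then show "racah_rel p r" by (simp add: racah_rel_def algebra_simps)
  qed
qed

text \<open>The constant coefficient is multiplicative and vanishes on the relators, so the quotient is
  nontrivial, as class \<open>ring_1\<close> requires.\<close>

lemma racah_word_add_eq_0_iff: "0 = u + v \<longleftrightarrow> u = 0 \<and> v = (0 :: racah_word)"
  by (cases u; cases v) (auto simp: zero_racah_word_def plus_racah_word_def)

lemma lookup_zero_mult:
  fixes p q :: "'f::field racah_free"
  shows "Poly_Mapping.lookup (p * q) 0 = Poly_Mapping.lookup p 0 * Poly_Mapping.lookup q 0"
proof -
  have "Poly_Mapping.lookup (p * q) 0 = (\<Sum>l. Poly_Mapping.lookup p l * (\<Sum>r. Poly_Mapping.lookup q r when 0 = l + r))"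
    by (simp add: lookup_mult)
  also have "\<dots> = (\<Sum>l. Poly_Mapping.lookup p l * Poly_Mapping.lookup q l when l = 0)"
    by (rule Sum_any.cong) (auto simp: racah_word_add_eq_0_iff when_def)
  finally show ?thesis by simp
qed

lemma lookup_zero_free_gen: "Poly_Mapping.lookup (free_gen x) 0 = 0"
  by (simp add: free_gen_def lookup_single when_def zero_racah_word_def)

lemma lookup_zero_racah_relators: "r \<in> racah_relators \<Longrightarrow> Poly_Mapping.lookup r 0 = 0"
  by (auto simp: racah_relators_def Let_def commutator_def lookup_minus lookup_zero_mult
      lookup_zero_free_gen mult.commute)

lemma lookup_zero_racah_ideal: "r \<in> racah_ideal \<Longrightarrow> Poly_Mapping.lookup r 0 = 0"
  by (induction rule: racah_ideal.induct)
    (simp_all add: lookup_zero_racah_relators lookup_add lookup_zero_mult)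

quotient_type (overloaded) 'f racah = "'f::field racah_free" / racah_rel
  by (rule equivp_racah_rel)

instantiation racah :: (field) ring_1
begin

lift_definition zero_racah :: "'a racah" is 0 .

lift_definition one_racah :: "'a racah" is 1 .

lift_definition plus_racah :: "'a racah \<Rightarrow> 'a racah \<Rightarrow> 'a racah" is "(+)"
proof -
  fix p p' q q' :: "'a racah_free"
  assume "racah_rel p p'" "racah_rel q q'"
  then have "(p - p') + (q - q') \<in> racah_ideal"
    unfolding racah_rel_def by (rule racah_ideal.add)
  then show "racah_rel (p + q) (p' + q')"
    by (simp add: racah_rel_def algebra_simps)
qed

lift_definition uminus_racah :: "'a racah \<Rightarrow> 'a racah" is uminus
proof -
  fix p p' :: "'a racah_free"
  assume "racah_rel p p'"
  then have "- (p - p') \<in> racah_ideal"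
    unfolding racah_rel_def by (rule racah_ideal_uminus)
  then show "racah_rel (- p) (- p')"
    by (simp add: racah_rel_def)
qed

lift_definition minus_racah :: "'a racah \<Rightarrow> 'a racah \<Rightarrow> 'a racah" is "(-)"
proof -
  fix p p' q q' :: "'a racah_free"
  assume "racah_rel p p'" "racah_rel q q'"
  then have "(p - p') - (q - q') \<in> racah_ideal"
    unfolding racah_rel_def by (rule racah_ideal_diff)
  then show "racah_rel (p - q) (p' - q')"
    by (simp add: racah_rel_def algebra_simps)
qed

lift_definition times_racah :: "'a racah \<Rightarrow> 'a racah \<Rightarrow> 'a racah" is "(*)"
proof -
  fix p p' q q' :: "'a racah_free"
  assume "racah_rel p p'" "racah_rel q q'"
  then have "(p - p') * q + p' * (q - q') \<in> racah_ideal"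
    unfolding racah_rel_def
    by (intro racah_ideal.add racah_ideal.mult_left racah_ideal.mult_right)
  then show "racah_rel (p * q) (p' * q')"
    by (simp add: racah_rel_def algebra_simps)
qed

instance
proof
  fix x y z :: "'a racah"
  show "x * y * z = x * (y * z)" by transfer (simp add: mult.assoc equivp_reflp[OF equivp_racah_rel])
  show "1 * x = x" by transfer (simp add: equivp_reflp[OF equivp_racah_rel])
  show "x * 1 = x" by transfer (simp add: equivp_reflp[OF equivp_racah_rel])
  show "x + y + z = x + (y + z)"
    by transfer (simp add: add.assoc equivp_reflp[OF equivp_racah_rel])
  show "x + y = y + x" by transfer (simp add: add.commute equivp_reflp[OF equivp_racah_rel])
  show "0 + x = x" by transfer (simp add: equivp_reflp[OF equivp_racah_rel])
  show "- x + x = 0" by transfer (simp add: equivp_reflp[OF equivp_racah_rel])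
  show "x - y = x + - y" by transfer (simp add: equivp_reflp[OF equivp_racah_rel])
  show "(x + y) * z = x * z + y * z"
    by transfer (simp add: algebra_simps equivp_reflp[OF equivp_racah_rel])
  show "x * (y + z) = x * y + x * z"
    by transfer (simp add: algebra_simps equivp_reflp[OF equivp_racah_rel])
  show "(0 :: 'a racah) \<noteq> 1"
    by transfer (auto simp: racah_rel_def dest: lookup_zero_racah_ideal)
qed

end

lift_definition racah_const :: "'f::field \<Rightarrow> 'f racah" is free_const .

definition racah_scale :: "'f::field \<Rightarrow> 'f racah \<Rightarrow> 'f racah"
  where "racah_scale c x = racah_const c * x"

lift_definition racah_gen :: "racah_gen \<Rightarrow> 'f::field racah" is free_gen .

definition racah_A :: "'f::field racah" where "racah_A = racah_gen GA"
definition racah_B :: "'f::field racah" where "racah_B = racah_gen GB"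
definition racah_C :: "'f::field racah" where "racah_C = racah_gen GC"
definition racah_D :: "'f::field racah" where "racah_D = racah_gen GD"

definition racah_alpha :: "'f::field racah"
  where "racah_alpha = alpha_expr racah_A racah_B racah_C racah_D"
definition racah_beta :: "'f::field racah"
  where "racah_beta = beta_expr racah_A racah_B racah_C racah_D"
definition racah_gamma :: "'f::field racah"
  where "racah_gamma = gamma_expr racah_A racah_B racah_C racah_D"
definition racah_delta :: "'f::field racah"
  where "racah_delta = racah_A + racah_B + racah_C"

lemma free_const_commute: "free_const c * p = p * free_const c"
proof (induction p rule: update_induct)
  case const
  then show ?case by simp
next
  case (update f a b)
  have "Poly_Mapping.update a b f = f + Poly_Mapping.single a b"
    using update.hyps(1)
    by (intro poly_mapping_eqI)
      (auto simp: Poly_Mapping.lookup_update lookup_add lookup_single when_def in_keys_iff)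
  then show ?case
    using update.IH by (simp add: algebra_simps free_const_def mult_single mult.commute)
qed

lemma free_const_add: "free_const (c + d) = free_const c + free_const d"
  by (simp add: free_const_def single_add)

lemma free_const_mult: "free_const (c * d) = free_const c * free_const d"
  by (simp add: free_const_def mult_single)

lemma free_const_one: "free_const 1 = 1"
  by (simp add: free_const_def)

lemma racah_const_commute: "racah_const c * x = x * racah_const c"
  by transfer (simp add: free_const_commute equivp_reflp[OF equivp_racah_rel])

lemma racah_const_add: "racah_const (c + d) = racah_const c + racah_const d"
  by transfer (simp add: free_const_add equivp_reflp[OF equivp_racah_rel])

lemma racah_const_mult: "racah_const (c * d) = racah_const c * racah_const d"
  by transfer (simp add: free_const_mult equivp_reflp[OF equivp_racah_rel])

lemma racah_const_one: "racah_const 1 = 1"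
  by transfer (simp add: free_const_one equivp_reflp[OF equivp_racah_rel])

interpretation racah: vector_space racah_scale
  by standard
    (simp_all add: racah_scale_def racah_const_add racah_const_mult racah_const_one algebra_simps)

lemma racah_scale_mult_left: "racah_scale c x * y = racah_scale c (x * y)"
  by (simp add: racah_scale_def mult.assoc)

lemma racah_scale_mult_right: "x * racah_scale c y = racah_scale c (x * y)"
  by (metis racah_scale_def mult.assoc racah_const_commute)

lemma abs_racah_hom:
  "abs_racah (p + q) = abs_racah p + abs_racah q"
  "abs_racah (p - q) = abs_racah p - abs_racah q"
  "abs_racah (p * q) = abs_racah p * abs_racah q"
  "abs_racah 0 = 0" "abs_racah 1 = 1"
  by (simp_all add: plus_racah.abs_eq minus_racah.abs_eq times_racah.abs_eq zero_racah_def
      one_racah_def)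

lemma abs_racah_expr:
  "abs_racah (commutator p q) = commutator (abs_racah p) (abs_racah q)"
  "abs_racah (alpha_expr p q r t) =
    alpha_expr (abs_racah p) (abs_racah q) (abs_racah r) (abs_racah t)"
  "abs_racah (beta_expr p q r t) =
    beta_expr (abs_racah p) (abs_racah q) (abs_racah r) (abs_racah t)"
  "abs_racah (gamma_expr p q r t) =
    gamma_expr (abs_racah p) (abs_racah q) (abs_racah r) (abs_racah t)"
  "abs_racah (2 * p) = 2 * abs_racah p"
  by (simp_all add: commutator_def alpha_expr_def beta_expr_def gamma_expr_def abs_racah_hom mult_2)

lemma abs_racah_gen:
  "abs_racah (free_gen GA) = racah_A" "abs_racah (free_gen GB) = racah_B"
  "abs_racah (free_gen GC) = racah_C" "abs_racah (free_gen GD) = racah_D"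
  by (simp_all add: racah_A_def racah_B_def racah_C_def racah_D_def racah_gen.abs_eq)

lemma abs_racah_relator: "r \<in> racah_relators \<Longrightarrow> abs_racah r = 0"
  by (simp add: zero_racah_def racah.abs_eq_iff racah_rel_def racah_ideal.relator)

lemma racah_commutators:
  "commutator racah_A racah_B = 2 * (racah_D :: 'f::field racah)"
  "commutator racah_B racah_C = 2 * (racah_D :: 'f racah)"
  "commutator racah_C racah_A = 2 * (racah_D :: 'f racah)"
proof -
  note rel = abs_racah_relator[unfolded racah_relators_def Let_def]
  show "commutator racah_A racah_B = 2 * (racah_D :: 'f racah)"
    using rel[of "commutator (free_gen GA) (free_gen GB) - 2 * free_gen GD"]
    by (simp add: abs_racah_hom(2) abs_racah_expr abs_racah_gen)
  show "commutator racah_B racah_C = 2 * (racah_D :: 'f racah)"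
    using rel[of "commutator (free_gen GB) (free_gen GC) - 2 * free_gen GD"]
    by (simp add: abs_racah_hom(2) abs_racah_expr abs_racah_gen)
  show "commutator racah_C racah_A = 2 * (racah_D :: 'f racah)"
    using rel[of "commutator (free_gen GC) (free_gen GA) - 2 * free_gen GD"]
    by (simp add: abs_racah_hom(2) abs_racah_expr abs_racah_gen)
qed

lemma racah_central:
  "commutator racah_alpha x = 0" "commutator racah_beta x = 0" "commutator racah_gamma x = 0"
proof -
  obtain p where p: "x = abs_racah p" by (metis Quotient_racah Quotient_rel_abs Quotient_abs_rep)
  note rel = abs_racah_relator[of "commutator _ p", unfolded racah_relators_def Let_def]
  show "commutator racah_alpha x = 0"
    unfolding p racah_alpha_def abs_racah_gen[symmetric] abs_racah_expr[symmetric]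
    by (rule rel) blast
  show "commutator racah_beta x = 0"
    unfolding p racah_beta_def abs_racah_gen[symmetric] abs_racah_expr[symmetric]
    by (rule rel) blast
  show "commutator racah_gamma x = 0"
    unfolding p racah_gamma_def abs_racah_gen[symmetric] abs_racah_expr[symmetric]
    by (rule rel) blast
qed


section \<open>Antiautomorphisms of the Racah algebra\<close>

definition racah_antiautomorphism :: "('f::field racah \<Rightarrow> 'f racah) \<Rightarrow> bool"
  where "racah_antiautomorphism f \<longleftrightarrow>
    Vector_Spaces.linear racah_scale racah_scale f \<and> bij f \<and>
    f 1 = 1 \<and> (\<forall>x y. f (x * y) = f y * f x)"

lemma free_induct [case_names zero single add]:
  assumes "P 0" "\<And>w c. P (Poly_Mapping.single w c)" "\<And>p q. P p \<Longrightarrow> P q \<Longrightarrow> P (p + q)"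
  shows "P (p :: 'f::field racah_free)"
proof (induction p rule: update_induct)
  case const
  then show ?case by (rule assms(1))
next
  case (update f a b)
  have "Poly_Mapping.update a b f = f + Poly_Mapping.single a b"
    using update.hyps(1)
    by (intro poly_mapping_eqI)
      (auto simp: Poly_Mapping.lookup_update lookup_add lookup_single when_def in_keys_iff)
  then show ?case using update.IH assms by metis
qed

lemma single_eq_const_mult: "Poly_Mapping.single w c = free_const c * Poly_Mapping.single w 1"
  by (simp add: free_const_def mult_single)

lemma single_Cons:
  "Poly_Mapping.single (Word (x # xs)) 1 = free_gen x * Poly_Mapping.single (Word xs) (1::'f::field)"
  by (simp add: free_gen_def mult_single plus_racah_word_def)

lemma single_Nil: "Poly_Mapping.single (Word []) 1 = (1 :: 'f::field racah_free)"
  by (simp add: zero_racah_word_def[symmetric])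

lemma racah_induct [case_names const gen add mult]:
  assumes const: "\<And>c. P (racah_const c)" and gen: "\<And>x. P (racah_gen x)"
    and add: "\<And>x y. P x \<Longrightarrow> P y \<Longrightarrow> P (x + y)" and mult: "\<And>x y. P x \<Longrightarrow> P y \<Longrightarrow> P (x * y)"
  shows "P (x :: 'f::field racah)"
proof -
  have word: "P (abs_racah (Poly_Mapping.single (Word xs) 1))" for xs
  proof (induction xs)
    case Nil
    then show ?case using const[of 1] by (simp add: single_Nil abs_racah_hom racah_const_one)
  next
    case (Cons a xs)
    then show ?case
      using mult[OF gen[of a]] by (simp add: single_Cons abs_racah_hom racah_gen.abs_eq)
  qed
  have single: "P (abs_racah (Poly_Mapping.single w c))" for w c
    unfolding single_eq_const_mult[of w c] abs_racah_hom racah_const.abs_eq[symmetric]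
    by (rule mult[OF const]) (cases w; simp add: word)
  have zero: "P 0"
    using const[of 0] by (simp add: racah_const.abs_eq free_const_def zero_racah_def)
  have "P (abs_racah p)" for p
    by (induction p rule: free_induct) (simp_all add: zero single add abs_racah_hom)
  then show ?thesis by (metis Quotient_racah Quotient_abs_rep)
qed

definition anti_word :: "(racah_gen \<Rightarrow> 'f::field racah) \<Rightarrow> racah_word \<Rightarrow> 'f racah"
  where "anti_word g w = prod_list (map g (rev (letters w)))"

definition anti_free :: "(racah_gen \<Rightarrow> 'f::field racah) \<Rightarrow> 'f racah_free \<Rightarrow> 'f racah"
  where "anti_free g p =
    (\<Sum>w\<in>Poly_Mapping.keys p. racah_scale (Poly_Mapping.lookup p w) (anti_word g w))"

lemma anti_word_add: "anti_word g (u + v) = anti_word g v * anti_word g u"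
  by (simp add: anti_word_def plus_racah_word_def)

lemma anti_free_superset:
  "finite S \<Longrightarrow> Poly_Mapping.keys p \<subseteq> S \<Longrightarrow>
    anti_free g p = (\<Sum>w\<in>S. racah_scale (Poly_Mapping.lookup p w) (anti_word g w))"
  unfolding anti_free_def
  by (rule sum.mono_neutral_left) (auto simp: in_keys_iff racah.scale_zero_left)

lemma anti_free_add: "anti_free g (p + q) = anti_free g p + anti_free g q"
proof -
  let ?S = "Poly_Mapping.keys p \<union> Poly_Mapping.keys q"
  have "Poly_Mapping.keys (p + q) \<subseteq> ?S" by (rule keys_add)
  then show ?thesis
    by (simp add: anti_free_superset[of ?S] lookup_add racah.scale_left_distrib sum.distrib)
qed

lemma anti_free_zero: "anti_free g 0 = 0"
  by (simp add: anti_free_def)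

lemma anti_free_single: "anti_free g (Poly_Mapping.single w c) = racah_scale c (anti_word g w)"
  by (simp add: anti_free_superset[of "{w}"])

lemma anti_free_mult: "anti_free g (p * q) = anti_free g q * anti_free g p"
proof (induction p rule: free_induct)
  case (single w c)
  show ?case
  proof (induction q rule: free_induct)
    case (single v d)
    then show ?case
      by (simp add: mult_single anti_free_single anti_word_add racah_scale_mult_left
          racah_scale_mult_right mult.commute)
  qed (simp_all add: anti_free_zero anti_free_add algebra_simps)
qed (simp_all add: anti_free_zero anti_free_add algebra_simps)

lemma anti_free_diff: "anti_free g (p - q) = anti_free g p - anti_free g q"
  using anti_free_add[of g "p - q" q] by (simp add: algebra_simps)

lemma anti_free_const: "anti_free g (free_const c) = racah_const c"
  by (simp add: free_const_def anti_free_single anti_word_def zero_racah_word_def racah_scale_def)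

lemma anti_free_gen: "anti_free g (free_gen x) = g x"
  by (simp add: free_gen_def anti_free_single anti_word_def)

lemma anti_free_ideal:
  assumes "\<And>r. r \<in> racah_relators \<Longrightarrow> anti_free g r = 0" and "p \<in> racah_ideal"
  shows "anti_free g p = 0"
  using assms(2) by (induction rule: racah_ideal.induct)
    (simp_all add: assms(1) anti_free_zero anti_free_add anti_free_mult)

definition racah_anti :: "(racah_gen \<Rightarrow> 'f::field racah) \<Rightarrow> 'f racah \<Rightarrow> 'f racah"
  where "racah_anti g x = anti_free g (rep_racah x)"

locale racah_anti_extension =
  fixes g :: "racah_gen \<Rightarrow> 'f::field racah"
  assumes relators: "r \<in> racah_relators \<Longrightarrow> anti_free g r = 0"
begin

lemma abs: "racah_anti g (abs_racah p) = anti_free g p"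
proof -
  have "racah_rel (rep_racah (abs_racah p)) p"
    by (metis Quotient_racah Quotient_rep_abs equivp_reflp[OF equivp_racah_rel])
  then have "anti_free g (rep_racah (abs_racah p) - p) = 0"
    unfolding racah_rel_def by (rule anti_free_ideal[rotated]) (rule relators)
  then show ?thesis by (simp add: racah_anti_def anti_free_diff)
qed

lemma rep: obtains p where "x = abs_racah p"
  by (metis Quotient_racah Quotient_abs_rep)

lemma gen: "racah_anti g (racah_gen x) = g x"
  by (simp add: racah_gen.abs_eq abs anti_free_gen)

lemma const: "racah_anti g (racah_const c) = racah_const c"
  by (simp add: racah_const.abs_eq abs anti_free_const)

lemma add: "racah_anti g (x + y) = racah_anti g x + racah_anti g y"
  by (rule rep[of x], rule rep[of y]) (simp add: abs abs_racah_hom(1)[symmetric] anti_free_add)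

lemma mult: "racah_anti g (x * y) = racah_anti g y * racah_anti g x"
  by (rule rep[of x], rule rep[of y]) (simp add: abs abs_racah_hom(3)[symmetric] anti_free_mult)

lemma one: "racah_anti g 1 = 1"
  using const[of 1] by (simp add: racah_const_one)

lemma diff: "racah_anti g (x - y) = racah_anti g x - racah_anti g y"
  using add[of "x - y" y] by (simp add: algebra_simps)

lemma uminus: "racah_anti g (- x) = - racah_anti g x"
  using diff[of 0 x] diff[of 0 0] by simp

lemma linear: "Vector_Spaces.linear racah_scale racah_scale (racah_anti g)"
  by unfold_locales
    (simp_all add: add mult const racah_scale_def racah_const_commute)

lemma antiautomorphism: "bij (racah_anti g) \<Longrightarrow> racah_antiautomorphism (racah_anti g)"
  by (simp add: racah_antiautomorphism_def linear mult one)

lemmas simps = gen const add mult one diff uminus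

end

fun sigma_gen :: "racah_gen \<Rightarrow> 'f::field racah" where
  "sigma_gen GA = racah_B"
| "sigma_gen GB = racah_A"
| "sigma_gen GC = racah_C"
| "sigma_gen GD = racah_D"

fun tau_gen :: "racah_gen \<Rightarrow> 'f::field racah" where
  "tau_gen GA = racah_B"
| "tau_gen GB = racah_C"
| "tau_gen GC = racah_A"
| "tau_gen GD = - racah_D"

lemma commutator_expand:
  "racah_A * racah_B = racah_B * racah_A + 2 * racah_D"
  "racah_B * racah_C = racah_C * racah_B + 2 * racah_D"
  "racah_C * racah_A = racah_A * racah_C + 2 * racah_D"
  using racah_commutators by (simp_all add: commutator_def algebra_simps)

lemma anti_free_commutator:
  "anti_free g (commutator p q) = commutator (anti_free g q) (anti_free g p)"
  by (simp add: commutator_def anti_free_diff anti_free_mult)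

lemma anti_free_two: "anti_free g (2 * p) = 2 * anti_free g p"
  by (simp add: mult_2 anti_free_add)

lemmas abc_expr_defs = alpha_expr_def beta_expr_def gamma_expr_def
lemmas racah_abc_defs = racah_alpha_def racah_beta_def racah_gamma_def

lemma sigma_expr:
  fixes a b c d :: "'f::field racah_free"
  defines "a \<equiv> free_gen GA" and "b \<equiv> free_gen GB" and "c \<equiv> free_gen GC" and "d \<equiv> free_gen GD"
  shows "anti_free sigma_gen (alpha_expr a b c d) = - racah_beta"
    and "anti_free sigma_gen (beta_expr a b c d) = - racah_alpha"
    and "anti_free sigma_gen (gamma_expr a b c d) = - racah_gamma"
  by (simp_all add: assms abc_expr_defs racah_abc_defs commutator_def anti_free_add anti_free_diff
      anti_free_mult anti_free_gen)

lemma tau_expr: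
  fixes a b c d :: "'f::field racah_free"
  defines "a \<equiv> free_gen GA" and "b \<equiv> free_gen GB" and "c \<equiv> free_gen GC" and "d \<equiv> free_gen GD"
  shows "anti_free tau_gen (alpha_expr a b c d) = racah_beta"
    and "anti_free tau_gen (beta_expr a b c d) = racah_gamma"
    and "anti_free tau_gen (gamma_expr a b c d) = racah_alpha"
  by (simp_all add: assms abc_expr_defs racah_abc_defs commutator_def anti_free_add anti_free_diff
      anti_free_mult anti_free_gen commutator_expand)

lemma commutator_central:
  "commutator x racah_alpha = 0" "commutator x racah_beta = 0" "commutator x racah_gamma = 0"
  "commutator x (- racah_alpha) = 0" "commutator x (- racah_beta) = 0"
  "commutator x (- racah_gamma) = 0"
  using racah_central[of x] by (simp_all add: commutator_def)

lemma anti_sigma: "racah_anti_extension (sigma_gen :: racah_gen \<Rightarrow> 'f::field racah)"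
proof
  fix r :: "'f racah_free"
  assume "r \<in> racah_relators"
  then show "anti_free sigma_gen r = 0"
    unfolding racah_relators_def Let_def
    by (auto simp: anti_free_commutator anti_free_diff anti_free_two anti_free_gen sigma_expr
        commutator_central) (simp_all add: commutator_def commutator_expand)
qed

lemma anti_tau: "racah_anti_extension (tau_gen :: racah_gen \<Rightarrow> 'f::field racah)"
proof
  fix r :: "'f racah_free"
  assume "r \<in> racah_relators"
  then show "anti_free tau_gen r = 0"
    unfolding racah_relators_def Let_def
    by (auto simp: anti_free_commutator anti_free_diff anti_free_two anti_free_gen tau_expr
        commutator_central) (simp_all add: commutator_def commutator_expand)
qed

abbreviation sigma_map :: "'f::field racah \<Rightarrow> 'f racah"
  where "sigma_map \<equiv> racah_anti sigma_gen"
abbreviation tau_map :: "'f::field racah \<Rightarrow> 'f racah"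
  where "tau_map \<equiv> racah_anti tau_gen"

lemmas sigma_simps = racah_anti_extension.simps[OF anti_sigma]
lemmas tau_simps = racah_anti_extension.simps[OF anti_tau]
lemmas gen_defs = racah_A_def racah_B_def racah_C_def racah_D_def

lemma sigma_map_sq: "sigma_map (sigma_map x) = x"
proof (induction x rule: racah_induct)
  case (gen x)
  then show ?case by (cases x) (simp_all add: sigma_simps gen_defs)
qed (simp_all add: sigma_simps)

lemma tau_map_six: "tau_map (tau_map (tau_map (tau_map (tau_map (tau_map x))))) = x"
proof (induction x rule: racah_induct)
  case (gen x)
  then show ?case by (cases x) (simp_all add: tau_simps gen_defs)
qed (simp_all add: tau_simps)

lemma sigma_tau_map_sq: "sigma_map (tau_map (sigma_map (tau_map x))) = x"
proof (induction x rule: racah_induct)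
  case (gen x)
  then show ?case by (cases x) (simp_all add: sigma_simps tau_simps gen_defs)
qed (simp_all add: sigma_simps tau_simps)

lemma bij_sigma: "bij sigma_map"
  by (rule o_bij[of sigma_map]) (simp_all add: fun_eq_iff sigma_map_sq)

lemma bij_tau: "bij tau_map"
  by (rule o_bij[of "\<lambda>x. tau_map (tau_map (tau_map (tau_map (tau_map x))))"])
    (simp_all add: fun_eq_iff tau_map_six)

lemma racah_antiautomorphism_eqI:
  assumes "racah_antiautomorphism f" "racah_antiautomorphism f'"
    and "f racah_A = f' racah_A" "f racah_B = f' racah_B"
    and "f racah_C = f' racah_C" "f racah_D = f' racah_D"
  shows "f = f'"
proof
  have const: "h (racah_const c) = racah_const c" if "racah_antiautomorphism h" for h c
  proof -
    have lin: "Vector_Spaces.linear racah_scale racah_scale h" and one: "h 1 = 1"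
      using that by (simp_all add: racah_antiautomorphism_def)
    show ?thesis
      using Vector_Spaces.linear.axioms(3)[OF lin] one
      by (metis module_hom.scale racah_scale_def mult_1_right linear_iff_module_hom lin)
  qed
  have add: "h (x + y) = h x + h y" if "racah_antiautomorphism h" for h x y
    using that unfolding racah_antiautomorphism_def linear_iff_module_hom
    by (blast dest: module_hom.add)
  have mult: "h (x * y) = h y * h x" if "racah_antiautomorphism h" for h x y
    using that by (simp add: racah_antiautomorphism_def)
  show "f x = f' x" for x
  proof (induction x rule: racah_induct)
    case (gen x)
    then show ?case using assms(3-6) by (cases x) (simp_all add: gen_defs)
  qed (simp_all add: const add mult assms(1,2))
qed


section \<open>The dihedral group and its action\<close>

text \<open>The group presented by two generators and the relators \<open>\<sigma>\<^sup>2\<close>, \<open>\<tau>\<^sup>6\<close>, \<open>(\<sigma>\<tau>)\<^sup>2\<close>.  A letter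
  \<open>(x, True)\<close> stands for the generator \<open>x\<close>, and \<open>(x, False)\<close> for its formal inverse.\<close>

datatype d6_gen = Sig | Tau

type_synonym d6_word = "(d6_gen \<times> bool) list"

inductive d6_rel :: "d6_word \<Rightarrow> d6_word \<Rightarrow> bool" where
  cancel: "d6_rel [(x, e), (x, \<not> e)] []"
| sigma_sq: "d6_rel [(Sig, True), (Sig, True)] []"
| tau_six: "d6_rel (replicate 6 (Tau, True)) []"
| sigma_tau_sq: "d6_rel [(Sig, True), (Tau, True), (Sig, True), (Tau, True)] []"
| refl: "d6_rel u u"
| sym: "d6_rel u v \<Longrightarrow> d6_rel v u"
| trans: "d6_rel u v \<Longrightarrow> d6_rel v w \<Longrightarrow> d6_rel u w"
| append: "d6_rel u v \<Longrightarrow> d6_rel u' v' \<Longrightarrow> d6_rel (u @ u') (v @ v')"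

quotient_type d6 = d6_word / d6_rel
  by (intro equivpI reflpI sympI transpI) (auto intro: d6_rel.intros)

lift_definition d6_mult :: "d6 \<Rightarrow> d6 \<Rightarrow> d6" is "(@)"
  by (rule d6_rel.append)

lift_definition d6_one :: d6 is "[]" .

lift_definition d6_sigma :: d6 is "[(Sig, True)]" .

lift_definition d6_tau :: d6 is "[(Tau, True)]" .

definition D6 :: "d6 monoid"
  where "D6 = \<lparr>carrier = UNIV, mult = d6_mult, one = d6_one\<rparr>"

lemma d6_rel_inverse: "d6_rel (rev (map (\<lambda>(x, e). (x, \<not> e)) w) @ w) []"
proof (induction w)
  case Nil
  then show ?case by (simp add: d6_rel.refl)
next
  case (Cons a w)
  obtain x e where a: "a = (x, e)" by (cases a)
  let ?v = "rev (map (\<lambda>(x, e). (x, \<not> e)) w)"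
  have "d6_rel [(x, \<not> e), (x, e)] []"
    using d6_rel.cancel[of x "\<not> e"] by simp
  then have "d6_rel (?v @ [(x, \<not> e), (x, e)] @ w) (?v @ [] @ w)"
    by (intro d6_rel.append d6_rel.refl)
  then show ?case using Cons.IH by (auto simp: a intro: d6_rel.trans)
qed

lemma group_D6: "group D6"
proof (rule groupI)
  fix x y z assume "x \<in> carrier D6" "y \<in> carrier D6" "z \<in> carrier D6"
  show "x \<otimes>\<^bsub>D6\<^esub> y \<otimes>\<^bsub>D6\<^esub> z = x \<otimes>\<^bsub>D6\<^esub> (y \<otimes>\<^bsub>D6\<^esub> z)"
    by (simp add: D6_def) (transfer, simp add: d6_rel.refl)
next
  fix x assume "x \<in> carrier D6"
  show "\<one>\<^bsub>D6\<^esub> \<otimes>\<^bsub>D6\<^esub> x = x"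
    by (simp add: D6_def) (transfer, simp add: d6_rel.refl)
  have "\<exists>y. d6_mult y x = d6_one"
    by transfer (use d6_rel_inverse in blast)
  then show "\<exists>y\<in>carrier D6. y \<otimes>\<^bsub>D6\<^esub> x = \<one>\<^bsub>D6\<^esub>" by (simp add: D6_def)
qed (simp_all add: D6_def)

definition d6_act :: "(d6_gen \<Rightarrow> 'a \<Rightarrow> 'a) \<Rightarrow> d6_word \<Rightarrow> 'a \<Rightarrow> 'a"
  where "d6_act m w = foldr (\<lambda>(x, e) f. (if e then m x else inv_into UNIV (m x)) \<circ> f) w id"

lemma d6_act_append: "d6_act m (u @ v) = d6_act m u \<circ> d6_act m v"
  by (induction u) (auto simp: d6_act_def fun_eq_iff)

lemma d6_act_bij: "(\<And>x. bij (m x)) \<Longrightarrow> bij (d6_act m w)"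
  by (induction w) (auto simp: d6_act_def intro!: bij_comp bij_imp_bij_inv split: if_splits)

lemma d6_act_rel:
  assumes "d6_rel u v" and bij: "\<And>x. bij (m x)"
    and "\<And>x. m Sig (m Sig x) = x"
    and "\<And>x. m Tau (m Tau (m Tau (m Tau (m Tau (m Tau x))))) = x"
    and "\<And>x. m Sig (m Tau (m Sig (m Tau x))) = x"
  shows "d6_act m u = d6_act m v"
  using assms(1)
proof induction
  case (cancel x e)
  then show ?case
    using bij[of x]
    by (auto simp: d6_act_def fun_eq_iff bij_is_inj bij_is_surj surj_f_inv_f)
qed (simp_all add: d6_act_append, simp_all add: d6_act_def fun_eq_iff assms(3-5) eval_nat_numeral)

definition racah_D6_spec :: "(d6 \<Rightarrow> 'f::field racah \<Rightarrow> 'f racah) \<Rightarrow> bool"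
  where "racah_D6_spec \<phi> \<longleftrightarrow>
    group_action D6 UNIV \<phi> \<and>
    racah_antiautomorphism (\<phi> d6_sigma) \<and> racah_antiautomorphism (\<phi> d6_tau) \<and>
    \<phi> d6_sigma racah_A = racah_B \<and> \<phi> d6_sigma racah_B = racah_A \<and>
    \<phi> d6_sigma racah_C = racah_C \<and> \<phi> d6_sigma racah_D = racah_D \<and>
    \<phi> d6_sigma racah_alpha = - racah_beta \<and> \<phi> d6_sigma racah_beta = - racah_alpha \<and>
    \<phi> d6_sigma racah_gamma = - racah_gamma \<and> \<phi> d6_sigma racah_delta = racah_delta \<and>
    \<phi> d6_tau racah_A = racah_B \<and> \<phi> d6_tau racah_B = racah_C \<and>
    \<phi> d6_tau racah_C = racah_A \<and> \<phi> d6_tau racah_D = - racah_D \<and>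
    \<phi> d6_tau racah_alpha = racah_beta \<and> \<phi> d6_tau racah_beta = racah_gamma \<and>
    \<phi> d6_tau racah_gamma = racah_alpha \<and> \<phi> d6_tau racah_delta = racah_delta"

lemma d6_action_eqI:
  assumes "group_action D6 UNIV \<phi>" "group_action D6 UNIV \<psi>"
    and "\<phi> d6_sigma = \<psi> d6_sigma" "\<phi> d6_tau = \<psi> d6_tau"
  shows "\<phi> = \<psi>"
proof
  fix g
  have mult: "\<chi> (abs_d6 (u @ v)) = \<chi> (abs_d6 u) \<circ> \<chi> (abs_d6 v)"
    and one: "\<chi> (abs_d6 []) = id" and bij: "bij (\<chi> (abs_d6 u))"
    if "group_action D6 UNIV \<chi>" for \<chi> :: "d6 \<Rightarrow> 'a \<Rightarrow> 'a" and u v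
  proof -
    interpret group_action D6 UNIV \<chi> by (rule that)
    show "\<chi> (abs_d6 (u @ v)) = \<chi> (abs_d6 u) \<circ> \<chi> (abs_d6 v)"
      using composition_rule[of _ "abs_d6 u" "abs_d6 v"]
      by (auto simp: D6_def d6_mult.abs_eq fun_eq_iff)
    show "\<chi> (abs_d6 []) = id"
      using id_eq_one by (auto simp: D6_def d6_one_def fun_eq_iff restrict_def)
    show "bij (\<chi> (abs_d6 u))"
      using bij_prop0[of "abs_d6 u"] by (simp add: D6_def Bij_def)
  qed
  have pos: "\<phi> (abs_d6 [(x, True)]) = \<psi> (abs_d6 [(x, True)])" for x
    using assms(3,4) by (cases x) (simp_all add: d6_sigma_def d6_tau_def)
  have inv: "\<chi> (abs_d6 [(x, False)]) = inv_into UNIV (\<chi> (abs_d6 [(x, True)]))"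
    if "group_action D6 UNIV \<chi>" for \<chi> :: "d6 \<Rightarrow> 'a \<Rightarrow> 'a" and x
  proof -
    have "abs_d6 ([(x, False)] @ [(x, True)]) = abs_d6 []"
      using d6_rel.cancel[of x False] by (simp add: d6.abs_eq_iff)
    moreover have "abs_d6 ([(x, True)] @ [(x, False)]) = abs_d6 []"
      using d6_rel.cancel[of x True] by (simp add: d6.abs_eq_iff)
    ultimately show ?thesis
      using mult[OF that] one[OF that] by (metis inv_unique_comp)
  qed
  have letter: "\<phi> (abs_d6 [a]) = \<psi> (abs_d6 [a])" for a
    by (cases a rule: prod.exhaust; cases "snd a") (simp_all add: pos inv assms(1,2))
  have "\<phi> (abs_d6 w) = \<psi> (abs_d6 w)" for w
  proof (induction w)
    case Nil
    then show ?case by (simp add: one assms(1,2))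
  next
    case (Cons a w)
    then show ?case
      using mult[OF assms(1), of "[a]" w] mult[OF assms(2), of "[a]" w] letter[of a] by simp
  qed
  then show "\<phi> g = \<psi> g" by (metis Quotient_d6 Quotient_abs_rep)
qed

theorem racah_D6_ex1: "\<exists>!\<phi> :: d6 \<Rightarrow> 'f::field racah \<Rightarrow> 'f racah. racah_D6_spec \<phi>"
proof (rule ex_ex1I)
  define m :: "d6_gen \<Rightarrow> 'f racah \<Rightarrow> 'f racah"
    where "m x = (case x of Sig \<Rightarrow> sigma_map | Tau \<Rightarrow> tau_map)" for x
  define \<phi> where "\<phi> g = d6_act m (rep_d6 g)" for g
  have bij: "bij (m x)" for x
    by (cases x) (simp_all add: m_def bij_sigma bij_tau)
  have abs: "\<phi> (abs_d6 w) = d6_act m w" for w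
  proof -
    have "d6_rel (rep_d6 (abs_d6 w)) w"
      by (metis Quotient_d6 Quotient_rep_abs d6_rel.refl)
    then show ?thesis
      unfolding \<phi>_def
      by (rule d6_act_rel) (rule bij, simp_all add: m_def sigma_map_sq tau_map_six sigma_tau_map_sq)
  qed
  have mult: "\<phi> (d6_mult g h) = \<phi> g \<circ> \<phi> h" for g h
  proof -
    obtain u v where "g = abs_d6 u" "h = abs_d6 v" by (metis Quotient_d6 Quotient_abs_rep)
    then show ?thesis by (simp add: d6_mult.abs_eq abs d6_act_append)
  qed
  have bij': "bij (\<phi> g)" for g
    unfolding \<phi>_def by (rule d6_act_bij) (rule bij)
  have act: "group_action D6 UNIV \<phi>"
    unfolding group_action_def group_hom_def group_hom_axioms_def
    by (intro conjI group_D6 group_BijGroup)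
      (auto simp: hom_def BijGroup_def Bij_def bij' mult compose_def D6_def
        fun_eq_iff)
  have sigma: "\<phi> d6_sigma = sigma_map" and tau: "\<phi> d6_tau = tau_map"
    by (simp_all add: d6_sigma_def d6_tau_def abs d6_act_def m_def)
  have "racah_D6_spec \<phi>"
    unfolding racah_D6_spec_def sigma tau
    by (intro conjI act racah_anti_extension.antiautomorphism anti_sigma anti_tau bij_sigma bij_tau)
      (simp_all add: gen_defs racah_abc_defs abc_expr_defs racah_delta_def commutator_def
        sigma_simps tau_simps, simp_all add: gen_defs[symmetric] commutator_expand)
  then show "\<exists>\<phi> :: d6 \<Rightarrow> 'f racah \<Rightarrow> 'f racah. racah_D6_spec \<phi>"
    by blast
next
  fix \<phi> \<psi> :: "d6 \<Rightarrow> 'f racah \<Rightarrow> 'f racah"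
  assume "racah_D6_spec \<phi>" "racah_D6_spec \<psi>"
  then show "\<phi> = \<psi>"
    unfolding racah_D6_spec_def
    by (intro d6_action_eqI racah_antiautomorphism_eqI) simp_all
qed

definition racah_D6_action :: "d6 \<Rightarrow> 'f::field racah \<Rightarrow> 'f racah"
  where "racah_D6_action = (THE \<phi>. racah_D6_spec \<phi>)"

lemma racah_D6_action_spec: "racah_D6_spec racah_D6_action"
  unfolding racah_D6_action_def by (rule theI'[OF racah_D6_ex1])


section \<open>The elements \<open>\<Omega>\<^sub>A\<close>, \<open>\<Omega>\<^sub>B\<close>, \<open>\<Omega>\<^sub>C\<close>\<close>

definition Omega_A :: "'f::field racah"
  where "Omega_A = racah_D ^ 2
    + racah_scale (1 / 2) (racah_B * racah_A * racah_C + racah_C * racah_A * racah_B)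
    + racah_A ^ 2 + racah_B * racah_gamma - racah_C * racah_beta - racah_A * racah_delta"

definition Omega_B :: "'f::field racah"
  where "Omega_B = racah_D ^ 2
    + racah_scale (1 / 2) (racah_C * racah_B * racah_A + racah_A * racah_B * racah_C)
    + racah_B ^ 2 + racah_C * racah_alpha - racah_A * racah_gamma - racah_B * racah_delta"

definition Omega_C :: "'f::field racah"
  where "Omega_C = racah_D ^ 2
    + racah_scale (1 / 2) (racah_A * racah_C * racah_B + racah_B * racah_C * racah_A)
    + racah_C ^ 2 + racah_A * racah_beta - racah_B * racah_alpha - racah_C * racah_delta"

end

theory Submission
  imports Defs
begin

text \<open>An antiautomorphism reverses products, so applying \<sigma> or \<tau> to an \<Omega>
  gives the target \<Omega> term by term. The two cubic words in the half-sum go to the two cubic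
  words of the target, squares go to squares, and only the mixed terms come out in the wrong order,
  such as \<open>- racah_gamma * racah_A\<close> for the image of
  \<open>racah_B * racah_gamma\<close> under \<sigma>. Two facts reorder them: \<alpha>, \<beta>,
  \<gamma> are central (\<open>racah_central_commute\<close>), and \<delta> commutes with A, B, C
  (\<open>racah_delta_commute\<close>). Invariance under the whole group then follows from the two
  generators by \<open>D6_action_image_eq\<close>.\<close>

lemma D6_action_image_eq:
  assumes act: "group_action D6 UNIV \<phi>"
    and sigma: "\<phi> d6_sigma ` S = S" and tau: "\<phi> d6_tau ` S = S"
  shows "\<phi> g ` S = S"
proof -
  interpret group_action D6 UNIV \<phi> by (rule act)
  have append: "\<phi> (abs_d6 (u @ v)) ` S = \<phi> (abs_d6 u) ` \<phi> (abs_d6 v) ` S" for u v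
    using composition_rule[of _ "abs_d6 u" "abs_d6 v"]
    by (auto simp: D6_def d6_mult.abs_eq image_image)
  have one: "\<phi> (abs_d6 []) ` S = S"
    using id_eq_one by (auto simp: D6_def d6_one_def fun_eq_iff restrict_def)
  have pos: "\<phi> (abs_d6 [(x, True)]) ` S = S" for x
    using sigma tau by (cases x) (simp_all add: d6_sigma_def d6_tau_def)
  \<comment> \<open>Since x maps S onto S, the image of S under the inverse of x equals its image
    under the trivial word. This needs equality of S with its image, not mere inclusion.\<close>
  have neg: "\<phi> (abs_d6 [(x, False)]) ` S = S" for x
  proof -
    have "abs_d6 ([(x, False)] @ [(x, True)]) = abs_d6 []"
      using d6_rel.cancel[of x False] by (simp add: d6.abs_eq_iff)
    then show ?thesis
      using append[of "[(x, False)]" "[(x, True)]"] by (simp add: one pos)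
  qed
  have letter: "\<phi> (abs_d6 [a]) ` S = S" for a
    by (cases a rule: prod.exhaust; cases "snd a") (simp_all add: pos neg)
  have "\<phi> (abs_d6 w) ` S = S" for w
  proof (induction w)
    case Nil
    show ?case by (rule one)
  next
    case (Cons a w)
    then show ?case using append[of "[a]" w] by (simp add: letter)
  qed
  then show ?thesis by (metis Quotient_d6 Quotient_abs_rep)
qed

lemma racah_antiautomorphism_hom:
  assumes "racah_antiautomorphism f"
  shows "f (x + y) = f x + f y" "f (x - y) = f x - f y" "f (racah_scale c x) = racah_scale c (f x)"
    "f (x * y) = f y * f x" "f (x ^ 2) = f x ^ 2"
proof -
  have hom: "module_hom racah_scale racah_scale f" and mult: "f (x * y) = f y * f x" for x y
    using assms by (simp_all add: racah_antiautomorphism_def linear_iff_module_hom)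
  show "f (x + y) = f x + f y" "f (x - y) = f x - f y" "f (racah_scale c x) = racah_scale c (f x)"
    using hom by (rule module_hom.add module_hom.diff module_hom.scale)+
  show "f (x * y) = f y * f x" "f (x ^ 2) = f x ^ 2"
    by (simp_all add: mult power2_eq_square)
qed

lemma racah_central_commute:
  "racah_alpha * x = x * racah_alpha" "racah_beta * x = x * racah_beta"
  "racah_gamma * x = x * racah_gamma"
  using racah_central[of x] by (simp_all add: commutator_def)

text \<open>The three commutators [A,B], [B,C], [C,A] are equal, so in the commutator of \<delta>
  with any one generator among A, B, C the two remaining terms cancel.\<close>

lemma racah_delta_commute:
  "racah_delta * racah_A = racah_A * (racah_delta :: 'f::field racah)"
  "racah_delta * racah_B = racah_B * (racah_delta :: 'f racah)"
  "racah_delta * racah_C = racah_C * (racah_delta :: 'f racah)"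
  using racah_commutators[where 'f = 'f]
  by (simp_all add: racah_delta_def commutator_def algebra_simps)

theorem lemma6p3:
  assumes "CHAR('f::field) \<noteq> 2"
  shows "(\<forall>g \<in> carrier D6.
        racah_D6_action g ` {Omega_A, Omega_B, Omega_C} = {Omega_A, Omega_B, Omega_C :: 'f racah}) \<and>
    racah_D6_action d6_sigma Omega_A = (Omega_B :: 'f racah) \<and>
    racah_D6_action d6_sigma Omega_B = (Omega_A :: 'f racah) \<and>
    racah_D6_action d6_sigma Omega_C = (Omega_C :: 'f racah) \<and>
    racah_D6_action d6_tau Omega_A = (Omega_B :: 'f racah) \<and>
    racah_D6_action d6_tau Omega_B = (Omega_C :: 'f racah) \<and>
    racah_D6_action d6_tau Omega_C = (Omega_A :: 'f racah)"
proof -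
  let ?\<phi> = "racah_D6_action :: d6 \<Rightarrow> 'f racah \<Rightarrow> 'f racah"
  note spec = racah_D6_action_spec[where 'a = 'f, unfolded racah_D6_spec_def]
  have act: "group_action D6 UNIV ?\<phi>"
    and anti: "racah_antiautomorphism (?\<phi> d6_sigma)" "racah_antiautomorphism (?\<phi> d6_tau)"
    using spec by simp_all
  note simps = Omega_A_def Omega_B_def Omega_C_def spec racah_antiautomorphism_hom[OF anti(1)]
    racah_antiautomorphism_hom[OF anti(2)] racah_central_commute racah_delta_commute
  \<comment> \<open>The signs that \<sigma> puts on \<alpha>, \<beta>, \<gamma> match the exchange
    of the positive and negative mixed terms.\<close>
  have sigma: "?\<phi> d6_sigma Omega_A = Omega_B" "?\<phi> d6_sigma Omega_B = Omega_A"
    "?\<phi> d6_sigma Omega_C = Omega_C"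
    by (simp_all add: simps algebra_simps)
  \<comment> \<open>\<tau> permutes A, B, C and \<alpha>, \<beta>, \<gamma> cyclically without
    signs; the sign on D vanishes in its square.\<close>
  have tau: "?\<phi> d6_tau Omega_A = Omega_B" "?\<phi> d6_tau Omega_B = Omega_C"
    "?\<phi> d6_tau Omega_C = Omega_A"
    by (simp_all add: simps algebra_simps)
  have "?\<phi> g ` {Omega_A, Omega_B, Omega_C} = {Omega_A, Omega_B, Omega_C}" for g
    by (rule D6_action_image_eq[OF act]) (auto simp: sigma tau)
  with sigma tau show ?thesis by blast
qed

end
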